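(* There is an absolute constant $C>0$ such that for every integer $n\ge2$ and every $\epsilon\in(0,1/4)$ there exist an integer $s\le C(\log n+\log\log(1/\epsilon)\cdot\log(1/\epsilon))$ and a function $G:\{0,1\}^s\to\mathbb{R}^n$ such that for every halfspace $h:\mathbb{R}^n\to\{-1,1\}$, $$\left|\mathbb{E}_{x\sim\mathcal{N}(0,1)^n}[h(x)]-\mathbb{E}_{y\sim\{0,1\}^s}[h(G(y))]\right|\le\epsilon .$$
   Context: A halfspace is a function $h(x)=\mathrm{sign}(\langle w,x\rangle-c)$ with $w\in\mathbb{R}^n$, $c\in\mathbb{R}$, where $\mathrm{sign}(z)=1$ for $z\ge0$ and $-1$ otherwise. $\mathcal{N}(0,1)^n$ is the standard Gaussian distribution on $\mathbb{R}^n$, and $y\sim\{0,1\}^s$ is uniform. *)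

theory Defs
  imports "HOL-Probability.Probability"
begin

text \<open>
  The dimension is quantified inside the theorem, after an absolute constant, so
  \<open>\<real>\<^sup>n\<close> is modelled as the functions on \<open>{..<n}\<close>. This is
  also the space of the product measure below.
\<close>

definition Rn :: "nat \<Rightarrow> (nat \<Rightarrow> real) set" where
  "Rn n = ({..<n} \<rightarrow>\<^sub>E UNIV)"

definition inner_prod :: "nat \<Rightarrow> (nat \<Rightarrow> real) \<Rightarrow> (nat \<Rightarrow> real) \<Rightarrow> real" where
  "inner_prod n w x = (\<Sum>i<n. w i * x i)"

text \<open>Unlike the library's \<open>sgn\<close>, this sign takes the value 1 at 0.\<close>

definition sign_pm :: "real \<Rightarrow> real" where
  "sign_pm z = (if z \<ge> 0 then 1 else - 1)"

definition halfspaces :: "nat \<Rightarrow> ((nat \<Rightarrow> real) \<Rightarrow> real) set" where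
  "halfspaces n = {(\<lambda>x. sign_pm (inner_prod n w x - c)) | w c. w \<in> Rn n}"

definition std_gaussian :: "nat \<Rightarrow> (nat \<Rightarrow> real) measure" where
  "std_gaussian n = (\<Pi>\<^sub>M i\<in>{..<n}. std_normal_distribution)"

definition bit_strings :: "nat \<Rightarrow> (nat \<Rightarrow> nat) set" where
  "bit_strings s = ({..<s} \<rightarrow>\<^sub>E {0, 1})"

end

theory Submission
  imports Defs
begin

text \<open>
  Nothing is asked of \<open>G\<close> beyond existence, so independent Gaussian samples indexed by
  the bit strings will do. By Hoeffding's inequality and a union bound, some sample of size
  polynomial in \<open>n / \<epsilon>\<close> has almost correct frequencies on the finitely many
  sets obtained by cutting a cube with halfspaces that have integer coefficients. Inside the cube,
  every halfspace lies between two parallel sets of this kind, and the Gaussian measure of the slab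
  between them is small, since one coefficient is large and the coordinate that it multiplies has
  bounded density given the others. The seed length is then \<open>O(log n + log (1 / \<epsilon>))\<close>.
\<close>

section \<open>Samples with correct frequencies on a finite family of events\<close>

text \<open>The probabilistic method on the product space
  \<open>Pi\<^sub>M I (\<lambda>_. M)\<close>: Hoeffding bounds the probability of a wrong frequency
  on each single event, and \<open>small\<close> says that these bounds add up to less than
  1.\<close>

lemma (in prob_space) exists_uniform_sample:
  fixes I :: "'i set"
  assumes I: "finite I" "I \<noteq> {}"
    and F: "finite F" "F \<subseteq> events"
    and e: "e \<ge> 0"
    and small: "2 * real (card F) * exp (- 2 * real (card I) * e\<^sup>2) < 1"
  shows "\<exists>x \<in> I \<rightarrow> space M. \<forall>A\<in>F. \<bar>prob A - measure_pmf.prob (map_pmf x (pmf_of_set I)) A\<bar> \<le> e"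
proof -
  interpret P: product_prob_space "\<lambda>_. M" I ..
  obtain i\<^sub>0 where i\<^sub>0: "i\<^sub>0 \<in> I"
    using I by auto
  let ?P = "Pi\<^sub>M I (\<lambda>_. M)"
  define bad where "bad A = {x \<in> space ?P. \<bar>(\<Sum>i\<in>I. indicator A (x i)) / real (card I) - prob A\<bar> \<ge> e}" for A
  have proj: "distr ?P M (\<lambda>x. x i) = M" if "i \<in> I" for i
    using that by (intro distr_PiM_component) (auto intro: prob_space_axioms)
  \<comment> \<open>Independence means that the joint law is the product of the marginals. Here the
    joint map is the identity on the product space and every marginal is \<open>M\<close>.\<close>
  have indep: "P.indep_vars (\<lambda>_. M) (\<lambda>i x. x i) I"
  proof (subst P.indep_vars_iff_distr_eq_PiM')
    have "distr ?P ?P (\<lambda>x. \<lambda>i\<in>I. x i) = distr ?P ?P (\<lambda>x. x)"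
      by (intro distr_cong) (auto simp: space_PiM)
    also have "\<dots> = Pi\<^sub>M I (\<lambda>i. distr ?P M (\<lambda>x. x i))"
      unfolding distr_id by (intro PiM_cong) (simp_all add: proj)
    finally show "distr ?P ?P (\<lambda>x. \<lambda>i\<in>I. x i) = Pi\<^sub>M I (\<lambda>i. distr ?P M (\<lambda>x. x i))" .
  qed (use I in auto)
  have bad: "P.prob (bad A) \<le> 2 * exp (- 2 * real (card I) * e\<^sup>2)" if A: "A \<in> F" for A
  proof -
    have [measurable]: "A \<in> events"
      using A F by auto
    have distr_ind: "distr ?P borel (\<lambda>x. indicator A (x i) :: real) = distr M borel (indicator A)"
      if "i \<in> I" for i
    proof -
      have "distr M borel (indicator A) = distr (distr ?P M (\<lambda>x. x i)) borel (indicator A :: _ \<Rightarrow> real)"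
        using that by (simp add: proj)
      also have "\<dots> = distr ?P borel (\<lambda>x. indicator A (x i))"
        using that by (subst distr_distr) (auto simp: o_def)
      finally show ?thesis ..
    qed
    have exp_ind: "P.expectation (\<lambda>x. indicator A (x i\<^sub>0)) = prob A"
    proof -
      have "P.expectation (\<lambda>x. indicator A (x i\<^sub>0)) = integral\<^sup>L (distr ?P borel (\<lambda>x. indicator A (x i\<^sub>0) :: real)) (\<lambda>y. y)"
        using I i\<^sub>0 by (subst integral_distr) auto
      also have "\<dots> = expectation (indicator A)"
        using I i\<^sub>0 by (subst distr_ind, simp, subst integral_distr) auto
      also have "\<dots> = prob A"
        by simp
      finally show ?thesis .
    qed
    \<comment> \<open>The indicators take values in [0, 1], so the Hoeffding exponent is -2 |I| e^2.
      The index \<open>i\<^sub>0\<close> only provides a reference variable with the common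
      law.\<close>
    interpret H: Hoeffding_ineq_iid ?P I "\<lambda>i x. indicator A (x i)" "\<lambda>x. indicator A (x i\<^sub>0)" 0 1 "prob A"
    proof unfold_locales
      show "P.indep_vars (\<lambda>_. borel) (\<lambda>i x. indicator A (x i) :: real) I"
        by (rule P.indep_vars_compose2[OF indep]) simp
      show "prob A \<equiv> P.expectation (\<lambda>x. indicator A (x i\<^sub>0))"
        using exp_ind by simp
      show "distr ?P borel (\<lambda>x. indicator A (x i)) = distr ?P borel (\<lambda>x. indicator A (x i\<^sub>0) :: real)"
        if "i \<in> I" for i
        using that i\<^sub>0 by (simp add: distr_ind)
      show "(\<lambda>x. indicator A (x i\<^sub>0) :: real) \<in> borel_measurable ?P"
        using i\<^sub>0 by measurable
    qed (use I in \<open>auto simp: indicator_def\<close>)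
    show ?thesis
      using H.Hoeffding_ineq_abs_ge'[OF e] I unfolding bad_def by simp
  qed
  have bad_sets [measurable]: "bad A \<in> P.events" if "A \<in> F" for A
  proof -
    have [measurable]: "A \<in> events"
      using that F by auto
    have [measurable]: "(\<lambda>x. indicator A (x i) :: real) \<in> borel_measurable ?P" if "i \<in> I" for i
      using that by (intro measurable_compose[OF measurable_component_singleton]) auto
    have "(\<lambda>x. \<Sum>i\<in>I. indicator A (x i) :: real) \<in> borel_measurable ?P"
      by (intro borel_measurable_sum) fact
    then show ?thesis
      unfolding bad_def by measurable
  qed
  have "P.prob (\<Union>A\<in>F. bad A) \<le> (\<Sum>A\<in>F. P.prob (bad A))"
    using F by (intro P.finite_measure_subadditive_finite) auto
  also have "\<dots> \<le> (\<Sum>A\<in>F. 2 * exp (- 2 * real (card I) * e\<^sup>2))"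
    by (intro sum_mono bad)
  also have "\<dots> < 1"
    using small by (simp add: mult_ac)
  finally have "P.prob (\<Union>A\<in>F. bad A) < 1" .
  moreover have "P.prob (space ?P) = 1"
    by (intro prob_space.prob_space prob_space_PiM prob_space_axioms)
  \<comment> \<open>A point of the product space is itself a function on \<open>I\<close>, so any
    point outside all bad events is the desired sample.\<close>
  ultimately have "(\<Union>A\<in>F. bad A) \<noteq> space ?P"
    by auto
  moreover have "(\<Union>A\<in>F. bad A) \<subseteq> space ?P"
    unfolding bad_def by auto
  ultimately obtain x where x: "x \<in> space ?P" "\<And>A. A \<in> F \<Longrightarrow> x \<notin> bad A"
    by blast
  show ?thesis
  proof (intro bexI ballI)
    show "x \<in> I \<rightarrow> space M"
      using x by (auto simp: space_PiM)
    fix A assume A: "A \<in> F"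
    have "measure_pmf.prob (map_pmf x (pmf_of_set I)) A = real (card (I \<inter> x -` A)) / real (card I)"
      using I by (simp add: measure_pmf_of_set)
    also have "real (card (I \<inter> x -` A)) = (\<Sum>i\<in>I. indicator A (x i))"
      using I by (simp add: indicator_def sum.If_cases vimage_def)
    finally show "\<bar>prob A - measure_pmf.prob (map_pmf x (pmf_of_set I)) A\<bar> \<le> e"
      using x A unfolding bad_def by (force simp: abs_minus_commute)
  qed
qed

section \<open>Anti-concentration and tails of the standard Gaussian\<close>

lemma prob_space_std_normal: "prob_space std_normal_distribution"
  by (rule prob_space_normal_density) simp

lemma product_prob_space_std_normal: "product_prob_space (\<lambda>_. std_normal_distribution)"
  by (simp add: product_prob_space_def product_prob_space_axioms_def product_sigma_finite_def
      prob_space_std_normal prob_space_imp_sigma_finite)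

lemma prob_space_std_gaussian: "prob_space (std_gaussian n)"
  unfolding std_gaussian_def by (intro prob_space_PiM prob_space_std_normal)

lemma space_std_gaussian [simp]: "space (std_gaussian n) = Rn n"
  by (simp add: std_gaussian_def space_PiM Rn_def)

lemma measurable_std_gaussian_component [measurable]:
  "i < n \<Longrightarrow> (\<lambda>x. x i) \<in> borel_measurable (std_gaussian n)"
  unfolding std_gaussian_def
  by (rule measurable_PiM_component_rev) auto

lemma measurable_inner_prod [measurable]: "inner_prod n w \<in> borel_measurable (std_gaussian n)"
  unfolding inner_prod_def by measurable

text \<open>The density never exceeds 1 / sqrt (2 pi), which is below 1. The cruder bound 1 lets
  interval lengths bound probabilities directly.\<close>

lemma emeasure_std_normal_le_lborel:
  assumes "A \<in> sets borel"
  shows "emeasure std_normal_distribution A \<le> emeasure lborel A"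
proof -
  have "std_normal_density x \<le> 1" for x
  proof -
    have "sqrt (2 * pi) \<ge> sqrt 1"
      using pi_gt3 by (intro real_sqrt_le_mono) linarith
    then have "1 / sqrt (2 * pi) * exp (- x\<^sup>2 / 2) \<le> 1 * 1"
      by (intro mult_mono) auto
    then show ?thesis
      by (simp add: std_normal_density_def)
  qed
  then have le: "ennreal (std_normal_density x) * indicator A x \<le> indicator A x" for x
    by (simp add: indicator_def)
  have "emeasure std_normal_distribution A = (\<integral>\<^sup>+x. ennreal (std_normal_density x) * indicator A x \<partial>lborel)"
    using assms by (intro emeasure_density) simp_all
  also have "\<dots> \<le> (\<integral>\<^sup>+x. indicator A x \<partial>lborel)"
    by (intro nn_integral_mono le)
  also have "\<dots> = emeasure lborel A"
    using assms by simp
  finally show ?thesis .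
qed

text \<open>Integrate over coordinate \<open>i\<close> first. With the other coordinates fixed, the
  slab confines \<open>x i\<close> to an interval of length (b - a) / |w i|, whose Gaussian mass is
  at most its length.\<close>

lemma std_gaussian_strip:
  assumes i: "i < n" and K: "K > 0" "\<bar>w i\<bar> \<ge> K" and ab: "a \<le> b"
  shows "measure (std_gaussian n) {x \<in> Rn n. inner_prod n w x \<in> {a..b}} \<le> (b - a) / K"
proof -
  interpret product_prob_space "\<lambda>_::nat. std_normal_distribution"
    by (rule product_prob_space_std_normal)
  interpret G: prob_space "std_gaussian n"
    by (rule prob_space_std_gaussian)
  let ?I = "{..<n} - {i}"
  define S where "S = {x \<in> Rn n. inner_prod n w x \<in> {a..b}}"
  have S: "S \<in> sets (std_gaussian n)"
    unfolding S_def space_std_gaussian [symmetric] by measurable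
  have ins: "insert i ?I = {..<n}"
    using i by auto
  have inner: "(\<integral>\<^sup>+y. indicator S (x(i := y)) \<partial>std_normal_distribution) \<le> ennreal ((b - a) / K)" for x
  proof -
    define r where "r = (\<Sum>j\<in>?I. w j * x j)"
    have inner_upd: "inner_prod n w (x(i := y)) = w i * y + r" for y
    proof -
      have "inner_prod n w (x(i := y)) = (\<Sum>j\<in>insert i ?I. w j * (x(i := y)) j)"
        by (simp only: inner_prod_def ins)
      also have "\<dots> = w i * y + r"
        by (subst sum.insert) (auto simp: r_def intro!: sum.cong)
      finally show ?thesis .
    qed
    \<comment> \<open>Dividing by a negative \<open>w i\<close> swaps the two endpoints.\<close>
    define c d where "c = (if w i > 0 then (a - r) / w i else (b - r) / w i)"
      and "d = (if w i > 0 then (b - r) / w i else (a - r) / w i)"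
    have sub: "y \<in> {c..d}" if "x(i := y) \<in> S" for y
      using that K unfolding S_def c_def d_def
      by (auto simp: inner_upd field_simps split: if_splits)
    have "c \<le> d"
      using ab K unfolding c_def d_def by (auto simp: divide_right_mono divide_right_mono_neg)
    have "(\<integral>\<^sup>+y. indicator S (x(i := y)) \<partial>std_normal_distribution)
        \<le> (\<integral>\<^sup>+y. indicator {c..d} y \<partial>std_normal_distribution)"
      using sub by (intro nn_integral_mono) (auto simp: indicator_def)
    also have "\<dots> = emeasure std_normal_distribution {c..d}"
      by simp
    also have "\<dots> \<le> emeasure lborel {c..d}"
      by (rule emeasure_std_normal_le_lborel) simp
    also have "\<dots> = ennreal (d - c)"
      using \<open>c \<le> d\<close> by simp
    also have "d - c = (b - a) / \<bar>w i\<bar>"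
      using K unfolding c_def d_def by (auto simp: field_simps)
    also have "ennreal \<dots> \<le> ennreal ((b - a) / K)"
      using K ab by (intro ennreal_leI divide_left_mono) auto
    finally show ?thesis .
  qed
  have "emeasure (std_gaussian n) S = (\<integral>\<^sup>+x. indicator S x \<partial>Pi\<^sub>M (insert i ?I) (\<lambda>_. std_normal_distribution))"
    using S unfolding ins std_gaussian_def by simp
  also have "\<dots> = (\<integral>\<^sup>+x. \<integral>\<^sup>+y. indicator S (x(i := y)) \<partial>std_normal_distribution
      \<partial>Pi\<^sub>M ?I (\<lambda>_. std_normal_distribution))"
    using S by (intro product_nn_integral_insert) (simp_all add: ins std_gaussian_def del: insert_Diff_single)
  also have "\<dots> \<le> (\<integral>\<^sup>+x. ennreal ((b - a) / K) \<partial>Pi\<^sub>M ?I (\<lambda>_. std_normal_distribution))"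
    by (intro nn_integral_mono inner)
  also have "\<dots> = ennreal ((b - a) / K)"
    by (simp add: prob_space.emeasure_space_1 prob_space_PiM prob_space_std_normal)
  finally show ?thesis
    using ab K by (simp add: G.emeasure_eq_measure S_def)
qed

text \<open>This is Chebyshev with mean 0 and variance 1. A polynomial tail suffices: a cube whose
  width is polynomial in n / \<epsilon> costs only a logarithmic number of seed bits.\<close>

lemma std_normal_tail:
  assumes "R > 0"
  shows "measure std_normal_distribution {x. \<bar>x\<bar> \<ge> R} \<le> 1 / R\<^sup>2"
proof -
  interpret prob_space std_normal_distribution
    by (rule prob_space_std_normal)
  have "integrable std_normal_distribution (\<lambda>x. x ^ 2)"
    by (rule integrable_std_normal_distribution_moment)
  moreover have "expectation (\<lambda>x. x) = 0"
    using integral_std_normal_distribution_moment_odd[of 1] by simp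
  moreover have "expectation (\<lambda>x. x\<^sup>2) = 1"
    using std_normal_distribution_even_moments(1)[of 1] by simp
  ultimately show ?thesis
    using Chebyshev_inequality[of "\<lambda>x. x" R] assms by simp
qed

lemma std_gaussian_cube_tail:
  assumes "R > 0"
  shows "measure (std_gaussian n) {x \<in> Rn n. \<exists>i<n. \<bar>x i\<bar> > R} \<le> real n / R\<^sup>2"
proof -
  interpret G: prob_space "std_gaussian n"
    by (rule prob_space_std_gaussian)
  have "measure (std_gaussian n) {x \<in> Rn n. \<bar>x i\<bar> \<ge> R} \<le> 1 / R\<^sup>2" if "i < n" for i
  proof -
    have "distr (std_gaussian n) std_normal_distribution (\<lambda>x. x i) = std_normal_distribution"
      using that prob_space_std_normal unfolding std_gaussian_def
      by (intro distr_PiM_component) auto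
    then have "measure std_normal_distribution {x. \<bar>x\<bar> \<ge> R}
        = measure (distr (std_gaussian n) std_normal_distribution (\<lambda>x. x i)) {x. \<bar>x\<bar> \<ge> R}"
      by simp
    also have "\<dots> = measure (std_gaussian n) {x \<in> Rn n. \<bar>x i\<bar> \<ge> R}"
      using that by (subst measure_distr) (auto intro!: arg_cong[where f="measure _"])
    finally show ?thesis
      using std_normal_tail[OF assms] by simp
  qed
  then have le: "(\<Sum>i<n. measure (std_gaussian n) {x \<in> Rn n. \<bar>x i\<bar> \<ge> R}) \<le> (\<Sum>i<n. 1 / R\<^sup>2)"
    by (intro sum_mono) auto
  have sets: "{x \<in> Rn n. \<bar>x i\<bar> \<ge> R} \<in> sets (std_gaussian n)" if "i < n" for i
    using that unfolding space_std_gaussian [symmetric] by measurable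
  have "measure (std_gaussian n) {x \<in> Rn n. \<exists>i<n. \<bar>x i\<bar> > R}
      \<le> measure (std_gaussian n) (\<Union>i<n. {x \<in> Rn n. \<bar>x i\<bar> \<ge> R})"
    using sets by (intro G.finite_measure_mono) force+
  also have "\<dots> \<le> (\<Sum>i<n. measure (std_gaussian n) {x \<in> Rn n. \<bar>x i\<bar> \<ge> R})"
    using sets by (intro G.finite_measure_subadditive_finite) auto
  also note le
  finally show ?thesis
    by simp
qed

section \<open>A finite family of integer halfspaces cut with a cube\<close>

definition cube :: "nat \<Rightarrow> real \<Rightarrow> (nat \<Rightarrow> real) set" where
  "cube n R = {x \<in> Rn n. \<forall>i<n. \<bar>x i\<bar> \<le> R}"

definition cell :: "nat \<Rightarrow> real \<Rightarrow> (nat \<Rightarrow> int) \<Rightarrow> int \<Rightarrow> (nat \<Rightarrow> real) set" where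
  "cell n R k j = {x \<in> cube n R. inner_prod n (\<lambda>i. real_of_int (k i)) x \<ge> real_of_int j}"

definition lattice_directions :: "nat \<Rightarrow> nat \<Rightarrow> (nat \<Rightarrow> int) set" where
  "lattice_directions n K = ({..<n} \<rightarrow>\<^sub>E {- int K..int K})"

text \<open>On the cube, an inner product with a lattice direction is at most
  \<open>n * K * R\<close> in absolute value. The lowest threshold therefore gives the whole cube,
  and the highest, one beyond that bound, gives the empty set.\<close>

definition cells :: "nat \<Rightarrow> nat \<Rightarrow> nat \<Rightarrow> (nat \<Rightarrow> real) set set" where
  "cells n R K = (\<lambda>(k, j). cell n (real R) k j) `
    (lattice_directions n K \<times> {- int (n * K * R)..int (n * K * R) + 1})"

lemma finite_lattice_directions [simp]: "finite (lattice_directions n K)"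
  by (simp add: lattice_directions_def finite_PiE)

lemma finite_cells [simp]: "finite (cells n R K)"
  by (simp add: cells_def)

lemma card_cells_le: "card (cells n R K) \<le> (2 * K + 1) ^ n * (2 * (n * K * R) + 2)"
proof -
  have "card (cells n R K) \<le> card (lattice_directions n K \<times> {- int (n * K * R)..int (n * K * R) + 1})"
    unfolding cells_def by (intro card_image_le) simp
  also have "\<dots> = nat (2 * int K + 1) ^ n * nat (2 * int (n * K * R) + 2)"
    by (simp add: card_cartesian_product lattice_directions_def card_PiE algebra_simps)
  also have "\<dots> = (2 * K + 1) ^ n * (2 * (n * K * R) + 2)"
    by (simp add: nat_add_distrib nat_mult_distrib)
  finally show ?thesis .
qed

lemma cube_in_sets [measurable]: "cube n R \<in> sets (std_gaussian n)"
proof -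
  have "cube n R = {x \<in> space (std_gaussian n). \<forall>i\<in>{..<n}. \<bar>x i\<bar> \<le> R}"
    by (auto simp: cube_def)
  also have "\<dots> \<in> sets (std_gaussian n)"
    by measurable
  finally show ?thesis .
qed

lemma halfspace_in_sets [measurable]: "{x \<in> Rn n. inner_prod n w x \<ge> c} \<in> sets (std_gaussian n)"
  unfolding space_std_gaussian [symmetric] by measurable

lemma cell_in_sets [measurable]: "cell n R k j \<in> sets (std_gaussian n)"
proof -
  have "cell n R k j = cube n R \<inter> {x \<in> Rn n. inner_prod n (\<lambda>i. real_of_int (k i)) x \<ge> real_of_int j}"
    by (auto simp: cell_def cube_def)
  then show ?thesis
    by (simp add: cube_in_sets halfspace_in_sets sets.Int)
qed

lemma abs_inner_prod_le:
  assumes "\<And>i. i < n \<Longrightarrow> \<bar>w i\<bar> \<le> a" and "x \<in> cube n R"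
  shows "\<bar>inner_prod n w x\<bar> \<le> real n * a * R"
proof -
  have "\<bar>inner_prod n w x\<bar> \<le> (\<Sum>i<n. \<bar>w i * x i\<bar>)"
    unfolding inner_prod_def by (rule sum_abs)
  also have "\<dots> \<le> (\<Sum>i<n. a * R)"
    using assms unfolding abs_mult cube_def
    by (intro sum_mono mult_mono) (auto intro: order_trans[OF abs_ge_zero])
  finally show ?thesis
    by simp
qed

text \<open>Clamping the threshold \<open>j\<close> to the range from -B to B + 1 does not change
  the cell, because inner products on the cube never leave the interval from -B to B. Finitely many
  thresholds thus represent all integers.\<close>

lemma cell_in_cells:
  assumes k: "k \<in> lattice_directions n K"
  shows "cell n (real R) k j \<in> cells n R K"
proof -
  define B where "B = int (n * K * R)"
  define j' where "j' = max (- B) (min j (B + 1))"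
  have "\<bar>inner_prod n (\<lambda>i. real_of_int (k i)) x\<bar> \<le> real_of_int B" if "x \<in> cube n (real R)" for x
  proof -
    have "\<bar>real_of_int (k i)\<bar> \<le> real K" if "i < n" for i
    proof -
      have "k i \<in> {- int K..int K}"
        using PiE_mem[OF k[unfolded lattice_directions_def], of i] that by simp
      then have "\<bar>k i\<bar> \<le> int K"
        by auto
      then show ?thesis
        by linarith
    qed
    from abs_inner_prod_le[OF this \<open>x \<in> cube n (real R)\<close>] show ?thesis
      by (simp add: B_def)
  qed
  moreover have "real_of_int j \<le> v \<longleftrightarrow> real_of_int j' \<le> v" if "\<bar>v\<bar> \<le> real_of_int B" for v
  proof -
    consider "j < - B" "j' = - B" | "- B \<le> j" "j \<le> B + 1" "j' = j" | "j > B + 1" "j' = B + 1"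
      unfolding j'_def B_def by linarith
    then show ?thesis
      using that by cases linarith+
  qed
  ultimately have "cell n (real R) k j = cell n (real R) k j'"
    unfolding cell_def by blast
  moreover have "j' \<in> {- B..B + 1}"
    by (auto simp: j'_def B_def)
  ultimately show ?thesis
    using k unfolding cells_def B_def by (intro image_eqI[of _ _ "(k, j')"]) auto
qed

text \<open>The zero direction with threshold 0 cuts nothing off. Having the cube in the family is
  what controls the mass that a sample puts outside it.\<close>

lemma cube_in_cells: "cube n (real R) \<in> cells n R K"
proof -
  have "cube n (real R) = cell n (real R) (\<lambda>i\<in>{..<n}. 0) 0"
    by (auto simp: cell_def inner_prod_def)
  also have "\<dots> \<in> cells n R K"
    by (rule cell_in_cells) (auto simp: lattice_directions_def)
  finally show ?thesis .
qed

section \<open>Sandwiching a halfspace between two parallel cells\<close>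

lemma inner_prod_scale: "inner_prod n (\<lambda>i. a * w i) x = a * inner_prod n w x"
  by (simp add: inner_prod_def sum_distrib_left mult.assoc)

text \<open>
  Scaling \<open>w\<close> so that its largest coordinate is \<open>\<plusminus>K\<close> makes that coordinate
  survive the rounding down to a lattice direction; the anti-concentration bound needs it.
\<close>

lemma halfspace_between_cells:
  assumes w: "i < n" "w i \<noteq> 0" and K: "K > 0"
  obtains k j\<^sub>1 j\<^sub>2 where "k \<in> lattice_directions n K" "\<exists>i<n. \<bar>k i\<bar> = int K"
    "j\<^sub>1 \<le> j\<^sub>2" "real_of_int j\<^sub>2 - real_of_int j\<^sub>1 \<le> 2 * real n * real R + 2"
    "{x \<in> cube n (real R). inner_prod n w x \<ge> c} \<subseteq> cell n (real R) k j\<^sub>1"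
    "cell n (real R) k j\<^sub>2 \<subseteq> {x \<in> cube n (real R). inner_prod n w x \<ge> c}"
proof -
  define m where "m = Max ((\<lambda>i. \<bar>w i\<bar>) ` {..<n})"
  have m_ge: "\<bar>w l\<bar> \<le> m" if "l < n" for l
    using that unfolding m_def by (intro Max_ge) auto
  have "m \<in> (\<lambda>i. \<bar>w i\<bar>) ` {..<n}"
    unfolding m_def using w by (intro Max_in) auto
  then obtain l where l: "l < n" "\<bar>w l\<bar> = m"
    by auto
  have m_pos: "m > 0"
    using m_ge[OF w(1)] w(2) by linarith
  define a where "a = real K / m"
  have a: "a > 0"
    using m_pos K by (simp add: a_def)
  define k where "k = (\<lambda>i\<in>{..<n}. \<lfloor>a * w i\<rfloor>)"
  have aw: "\<bar>a * w i\<bar> \<le> real K" if "i < n" for i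
    using mult_left_mono[OF m_ge[OF that], of a] a m_pos by (simp add: abs_mult a_def)
  have k: "k \<in> lattice_directions n K"
    using aw unfolding lattice_directions_def k_def
    by (auto simp: le_floor_iff abs_le_iff floor_le_iff) (smt (verit))+
  have "a * w l = real_of_int (int K) \<or> a * w l = real_of_int (- int K)"
    using l m_pos by (auto simp: a_def abs_if split: if_splits)
  moreover have "k l = \<lfloor>a * w l\<rfloor>"
    using l by (simp add: k_def)
  ultimately have "k l = int K \<or> k l = - int K"
    by (metis floor_of_int)
  then have "\<bar>k l\<bar> = int K"
    by auto
  then have kl: "\<exists>i<n. \<bar>k i\<bar> = int K"
    using l by auto
  \<comment> \<open>Rounding moves each of the n coefficients by at most 1, and each coordinate of a
    point in the cube is at most \<open>R\<close> in absolute value.\<close>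
  have close: "\<bar>a * inner_prod n w x - inner_prod n (\<lambda>i. real_of_int (k i)) x\<bar> \<le> real n * real R"
    if "x \<in> cube n (real R)" for x
  proof -
    have "a * inner_prod n w x - inner_prod n (\<lambda>i. real_of_int (k i)) x
        = inner_prod n (\<lambda>i. a * w i - real_of_int (k i)) x"
      by (simp add: inner_prod_def sum_distrib_left sum_subtractf algebra_simps)
    moreover have "\<bar>a * w i - real_of_int (k i)\<bar> \<le> 1" if "i < n" for i
      using that unfolding k_def by simp linarith
    ultimately show ?thesis
      using abs_inner_prod_le[of n "\<lambda>i. a * w i - real_of_int (k i)" 1 x "real R"] that by simp
  qed
  have scale: "inner_prod n w x \<ge> c \<longleftrightarrow> a * inner_prod n w x \<ge> a * c" for x
    using a by simp
  \<comment> \<open>The scaled threshold is shifted by the rounding error n R in either direction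
    and then rounded outwards to an integer. The two roundings account for the summand 2 in the
    gap.\<close>
  define j\<^sub>1 j\<^sub>2 where "j\<^sub>1 = \<lfloor>a * c - real n * real R\<rfloor>" and "j\<^sub>2 = \<lceil>a * c + real n * real R\<rceil>"
  have nR: "real n * real R \<ge> 0"
    by simp
  show ?thesis
  proof (rule that[OF k kl])
    show "j\<^sub>1 \<le> j\<^sub>2" "real_of_int j\<^sub>2 - real_of_int j\<^sub>1 \<le> 2 * real n * real R + 2"
      using nR unfolding j\<^sub>1_def j\<^sub>2_def by linarith+
    show "{x \<in> cube n (real R). inner_prod n w x \<ge> c} \<subseteq> cell n (real R) k j\<^sub>1"
    proof
      fix x assume x: "x \<in> {x \<in> cube n (real R). inner_prod n w x \<ge> c}"
      then show "x \<in> cell n (real R) k j\<^sub>1"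
        using close[of x] unfolding cell_def j\<^sub>1_def scale by simp linarith
    qed
    show "cell n (real R) k j\<^sub>2 \<subseteq> {x \<in> cube n (real R). inner_prod n w x \<ge> c}"
    proof
      fix x assume x: "x \<in> cell n (real R) k j\<^sub>2"
      then show "x \<in> {x \<in> cube n (real R). inner_prod n w x \<ge> c}"
        using close[of x] unfolding cell_def j\<^sub>2_def scale by simp linarith
    qed
  qed
qed

text \<open>Both measures of the halfspace lie between that of the inner cell and that of the outer
  cell plus the mass outside the cube. The two measures nearly agree on these cells and on the cube,
  while the Gaussian gap between the cells is a slab. When \<mu> exceeds the Gaussian measure,
  \<delta> is paid twice, for the outer cell and for the cube.\<close>

lemma halfspace_discrepancy_le:
  assumes \<delta>: "\<And>A. A \<in> cells n R K \<Longrightarrow> \<bar>measure (std_gaussian n) A - measure_pmf.prob \<mu> A\<bar> \<le> \<delta>"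
    and w: "i < n" "w i \<noteq> 0" and K: "K > 0" and R: "R > 0"
  shows "\<bar>measure (std_gaussian n) {x \<in> Rn n. inner_prod n w x \<ge> c}
      - measure_pmf.prob \<mu> {x \<in> Rn n. inner_prod n w x \<ge> c}\<bar>
    \<le> 2 * \<delta> + real n / (real R)\<^sup>2 + (2 * real n * real R + 2) / real K"
proof -
  interpret G: prob_space "std_gaussian n"
    by (rule prob_space_std_gaussian)
  define H where "H = {x \<in> Rn n. inner_prod n w x \<ge> c}"
  let ?B = "cube n (real R)"
  obtain k j\<^sub>1 j\<^sub>2 where k: "k \<in> lattice_directions n K" "\<exists>i<n. \<bar>k i\<bar> = int K"
    and j: "j\<^sub>1 \<le> j\<^sub>2" "real_of_int j\<^sub>2 - real_of_int j\<^sub>1 \<le> 2 * real n * real R + 2"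
    and outer: "{x \<in> ?B. inner_prod n w x \<ge> c} \<subseteq> cell n (real R) k j\<^sub>1"
    and inner: "cell n (real R) k j\<^sub>2 \<subseteq> {x \<in> ?B. inner_prod n w x \<ge> c}"
    by (rule halfspace_between_cells[where c=c and w=w and R=R, OF w K])
  define U V where "U = cell n (real R) k j\<^sub>1" and "V = cell n (real R) k j\<^sub>2"
  have [measurable]: "H \<in> G.events" "U \<in> G.events" "V \<in> G.events" "?B \<in> G.events"
    by (simp_all add: H_def U_def V_def halfspace_in_sets cell_in_sets cube_in_sets)
  have VH: "V \<subseteq> H" and HU: "H \<inter> ?B \<subseteq> U"
    using inner outer by (auto simp: H_def U_def V_def cube_def)

  \<comment> \<open>Points of \<open>U\<close> outside \<open>V\<close> lie in the slab between the
    two thresholds, and a coefficient of absolute value \<open>K\<close> makes this slab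
    thin.\<close>
  have strip: "G.prob U \<le> G.prob V + (2 * real n * real R + 2) / real K"
  proof -
    obtain l where l: "l < n" "\<bar>k l\<bar> = int K"
      using k by auto
    have l': "\<bar>real_of_int (k l)\<bar> \<ge> real K"
      using l by linarith
    define S where
      "S = {x \<in> Rn n. inner_prod n (\<lambda>i. real_of_int (k i)) x \<in> {real_of_int j\<^sub>1..real_of_int j\<^sub>2}}"
    have [measurable]: "S \<in> G.events"
      unfolding S_def space_std_gaussian [symmetric] by measurable
    have "U \<subseteq> V \<union> S"
    proof
      fix x assume "x \<in> U"
      then show "x \<in> V \<union> S"
        by (cases "inner_prod n (\<lambda>i. real_of_int (k i)) x \<ge> real_of_int j\<^sub>2")
          (simp_all add: U_def V_def S_def cell_def cube_def)
    qed
    then have "G.prob U \<le> G.prob (V \<union> S)"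
      by (intro G.finite_measure_mono) auto
    also have "\<dots> \<le> G.prob V + G.prob S"
      by (intro measure_Un_le) auto
    also have "G.prob S \<le> (real_of_int j\<^sub>2 - real_of_int j\<^sub>1) / real K"
      unfolding S_def using l l' j K by (intro std_gaussian_strip) auto
    also have "\<dots> \<le> (2 * real n * real R + 2) / real K"
      using j by (intro divide_right_mono) auto
    finally show ?thesis
      by simp
  qed
  define D where "D = space (std_gaussian n) - ?B"
  have [measurable]: "D \<in> G.events"
    unfolding D_def by measurable
  have prob_D: "G.prob D = 1 - G.prob ?B"
    unfolding D_def by (intro G.prob_compl cube_in_sets)
  have tail: "G.prob D \<le> real n / (real R)\<^sup>2"
  proof -
    have "D = {x \<in> Rn n. \<exists>i<n. \<bar>x i\<bar> > real R}"
      by (auto simp: D_def cube_def not_le)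
    then show ?thesis
      using R std_gaussian_cube_tail[of "real R" n] by simp
  qed
  have GH: "G.prob V \<le> G.prob H" "G.prob H \<le> G.prob U + G.prob D"
  proof -
    show "G.prob V \<le> G.prob H"
      using VH by (intro G.finite_measure_mono) auto
    have "H \<subseteq> U \<union> D"
      using HU by (auto simp: H_def D_def)
    then have "G.prob H \<le> G.prob (U \<union> D)"
      by (intro G.finite_measure_mono) auto
    also have "\<dots> \<le> G.prob U + G.prob D"
      by (intro measure_Un_le) auto
    finally show "G.prob H \<le> G.prob U + G.prob D" .
  qed
  \<comment> \<open>No tail bound is known for \<mu>. Its mass off the cube enters as 1 minus its
    mass on the cube, which is then compared with the Gaussian one.\<close>
  have MH: "measure_pmf.prob \<mu> V \<le> measure_pmf.prob \<mu> H"
    "measure_pmf.prob \<mu> H \<le> measure_pmf.prob \<mu> U + (1 - measure_pmf.prob \<mu> ?B)"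
  proof -
    show "measure_pmf.prob \<mu> V \<le> measure_pmf.prob \<mu> H"
      using VH by (intro measure_pmf.finite_measure_mono) auto
    have "measure_pmf.prob \<mu> H \<le> measure_pmf.prob \<mu> (U \<union> (UNIV - ?B))"
      using HU by (intro measure_pmf.finite_measure_mono) auto
    also have "\<dots> \<le> measure_pmf.prob \<mu> U + measure_pmf.prob \<mu> (UNIV - ?B)"
      by (intro measure_Un_le) auto
    finally show "measure_pmf.prob \<mu> H \<le> measure_pmf.prob \<mu> U + (1 - measure_pmf.prob \<mu> ?B)"
      using measure_pmf.prob_compl[of ?B \<mu>] by simp
  qed
  have "\<bar>G.prob U - measure_pmf.prob \<mu> U\<bar> \<le> \<delta>" "\<bar>G.prob V - measure_pmf.prob \<mu> V\<bar> \<le> \<delta>"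
    "\<bar>G.prob ?B - measure_pmf.prob \<mu> ?B\<bar> \<le> \<delta>"
    using k by (auto intro!: \<delta> cell_in_cells cube_in_cells simp: U_def V_def)
  then show ?thesis
    using strip tail prob_D GH MH unfolding H_def [symmetric] by linarith
qed

section \<open>Bit strings, expectations of signs and numerical estimates\<close>

lemma finite_bit_strings [simp]: "finite (bit_strings s)"
  by (simp add: bit_strings_def finite_PiE)

lemma card_bit_strings [simp]: "card (bit_strings s) = 2 ^ s"
  by (simp add: bit_strings_def card_PiE flip: numeral_2_eq_2)

lemma bit_strings_nonempty [simp]: "bit_strings s \<noteq> {}"
  by (metis card.empty card_bit_strings power_not_zero zero_neq_numeral)

text \<open>The sign is twice an indicator minus 1. Errors in probability therefore double in
  expectation, which is why the later estimates aim at \<epsilon> / 2.\<close>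

lemma integral_sign_pm:
  assumes "prob_space M" and H: "{x \<in> space M. f x \<ge> 0} \<in> sets M"
  shows "(LINT x|M. sign_pm (f x)) = 2 * measure M {x \<in> space M. f x \<ge> 0} - 1"
proof -
  interpret prob_space M by fact
  let ?H = "{x \<in> space M. f x \<ge> 0}"
  have "(LINT x|M. sign_pm (f x)) = (LINT x|M. 2 * indicator ?H x - 1)"
    by (intro Bochner_Integration.integral_cong) (auto simp: sign_pm_def)
  also have "\<dots> = 2 * prob ?H - 1"
    using H by (subst Bochner_Integration.integral_diff) (auto simp: prob_space less_top[symmetric])
  finally show ?thesis .
qed

text \<open>
  The constants come from cubes of half-width \<open>R = 2 * q\<close>, lattice directions bounded by
  \<open>K = 8 * q ^ 3\<close> and \<open>q ^ 7\<close> samples.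
\<close>

lemma sample_size_sufficient:
  fixes n t :: nat
  defines "q \<equiv> (2::real) ^ t"
  assumes \<epsilon>: "0 < \<epsilon>" "\<epsilon> < 1 / 4" and n: "n \<ge> 2" and q: "q \<ge> real n / \<epsilon>"
  shows "2 * ((16 * q ^ 3 + 1) ^ n * (32 * real n * q ^ 4 + 2)) * exp (- 2 * q ^ 7 * (\<epsilon> / 16)\<^sup>2) < 1"
proof -
  have n_le: "real n \<le> \<epsilon> * q"
    using q \<epsilon> by (simp add: field_simps)
  have q_pos: "q > 0"
    by (simp add: q_def)
  have n_q: "4 * real n \<le> q"
    using n_le \<epsilon> q_pos mult_right_mono[of \<epsilon> "1/4" q] by linarith
  have q8: "q \<ge> 8"
    using n_q n by linarith
  have q64: "q\<^sup>2 \<ge> 64"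
    using power_mono[OF q8, of 2] by simp
  have t_q: "real t \<le> q"
    unfolding q_def by (metis less_exp less_imp_le of_nat_le_iff of_nat_numeral of_nat_power)
  have q3: "q ^ 3 \<ge> 1" and q5: "q ^ 5 \<ge> 1"
    using q8 by (auto intro!: one_le_power)
  \<comment> \<open>Since q is at least 8, the factor q^2 absorbs constants up to 64, so the number
    of cells is bounded by a pure power of q, hence of 2.\<close>
  have "16 * q ^ 3 + 1 \<le> 64 * q ^ 3"
    using q3 by linarith
  also have "\<dots> \<le> q\<^sup>2 * q ^ 3"
    using q64 q_pos by (intro mult_right_mono) auto
  also have "\<dots> = q ^ 5"
    by (simp flip: power_add)
  finally have f1: "(16 * q ^ 3 + 1) ^ n \<le> (q ^ 5) ^ n"
    using q_pos by (intro power_mono) auto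
  have "8 * (4 * real n) * q ^ 4 \<le> 8 * q * q ^ 4"
    using n_q q_pos by (intro mult_right_mono) auto
  then have "2 * (32 * real n * q ^ 4 + 2) \<le> 16 * q ^ 5 + 4"
    by (simp add: power_numeral_reduce)
  also have "\<dots> \<le> 64 * q ^ 5"
    using q5 by linarith
  also have "\<dots> \<le> q\<^sup>2 * q ^ 5"
    using q64 q_pos by (intro mult_right_mono) auto
  also have "\<dots> = q ^ 7"
    by (simp flip: power_add)
  finally have f2: "2 * (32 * real n * q ^ 4 + 2) \<le> q ^ 7" .
  have "2 * ((16 * q ^ 3 + 1) ^ n * (32 * real n * q ^ 4 + 2))
      = (16 * q ^ 3 + 1) ^ n * (2 * (32 * real n * q ^ 4 + 2))"
    by simp
  also have "\<dots> \<le> (q ^ 5) ^ n * q ^ 7"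
    using f1 f2 q_pos by (intro mult_mono) auto
  also have "\<dots> = 2 ^ (t * (5 * n + 7))"
    by (simp add: q_def flip: power_mult power_add) (simp add: algebra_simps)
  also have "\<dots> \<le> exp 1 ^ (t * (5 * n + 7))"
    using exp_ge_add_one_self[of "1::real"] by (intro power_mono) auto
  also have "\<dots> = exp (real (t * (5 * n + 7)))"
    by (simp flip: exp_of_nat_mult)
  \<comment> \<open>The exponent on the left is at most 3 q^2, since t, 4 n and 8 are all at most q.
    On the right, \<epsilon> q is at least n, hence at least 2, so q^7 \<epsilon>^2 is at least 4
    q^5, which dominates.\<close>
  also have "\<dots> < exp (2 * q ^ 7 * (\<epsilon> / 16)\<^sup>2)"
  proof -
    have "real (t * (5 * n + 7)) = real t * (5 * real n + 7)"
      by simp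
    also have "\<dots> \<le> q * (3 * q)"
      using t_q n_q q8 by (intro mult_mono) auto
    also have "\<dots> = 3 * q\<^sup>2"
      by (simp add: power2_eq_square)
    also have "\<dots> < 16 * q\<^sup>2"
      using q_pos by simp
    also have "\<dots> = 8 ^ 3 * q\<^sup>2 / 32"
      by simp
    also have "\<dots> \<le> q ^ 3 * q\<^sup>2 / 32"
      using q8 q_pos by (intro divide_right_mono mult_right_mono power_mono) auto
    also have "\<dots> = 2 * q ^ 5 * (2 / 16)\<^sup>2"
      by (simp add: power2_eq_square power_numeral_reduce)
    also have "\<dots> \<le> 2 * q ^ 5 * (\<epsilon> * q / 16)\<^sup>2"
      using n_le n q_pos by (intro mult_left_mono power_mono) auto
    also have "\<dots> = 2 * q ^ 7 * (\<epsilon> / 16)\<^sup>2"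
      by (simp add: power2_eq_square power_numeral_reduce)
    finally show ?thesis
      by simp
  qed
  finally show ?thesis
    by (simp add: exp_minus field_simps)
qed

text \<open>As n is at least 2, 1 / q is at most \<epsilon> / 2. The sampling, tail and slab terms
  are then at most \<epsilon> / 8, \<epsilon> / 32 and \<epsilon> / 8.\<close>

lemma cells_error_le:
  fixes q :: real
  assumes \<epsilon>: "0 < \<epsilon>" "\<epsilon> < 1 / 4" and n: "n \<ge> 2" and q: "q \<ge> real n / \<epsilon>"
  shows "2 * (\<epsilon> / 16) + real n / (2 * q)\<^sup>2 + (2 * real n * (2 * q) + 2) / (8 * q ^ 3) \<le> \<epsilon> / 2"
proof -
  have n_le: "real n \<le> \<epsilon> * q"
    using q \<epsilon> by (simp add: field_simps)
  have q_pos: "q > 0"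
    using q n \<epsilon> by (smt (verit) divide_pos_pos of_nat_0_less_iff zero_less_numeral less_le_trans)
  have n_q: "4 * real n \<le> q"
    using n_le \<epsilon> q_pos mult_right_mono[of \<epsilon> "1/4" q] by linarith
  have q8: "q \<ge> 8"
    using n_q n by linarith
  have inv: "1 / q \<le> \<epsilon> / 2"
    using n_le n q_pos by (simp add: field_simps)
  have "real n / (2 * q)\<^sup>2 \<le> (q / 4) / (2 * q)\<^sup>2"
    using n_q by (intro divide_right_mono) auto
  also have "\<dots> = 1 / q / 16"
    using q_pos by (simp add: power2_eq_square)
  also have "\<dots> \<le> \<epsilon> / 32"
    using divide_right_mono[OF inv, of 16] by simp
  finally have tail: "real n / (2 * q)\<^sup>2 \<le> \<epsilon> / 32" .
  have "4 * real n * q \<le> q * q"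
    using n_q q_pos by (intro mult_right_mono) auto
  moreover have "8 * 8 \<le> q * q"
    using q8 by (intro mult_mono) auto
  ultimately have "2 * real n * (2 * q) + 2 \<le> 2 * q\<^sup>2"
    by (simp add: power2_eq_square)
  then have "(2 * real n * (2 * q) + 2) / (8 * q ^ 3) \<le> 2 * q\<^sup>2 / (8 * q ^ 3)"
    using q_pos by (intro divide_right_mono) auto
  also have "\<dots> = 1 / q / 4"
    using q_pos by (simp add: power2_eq_square power3_eq_cube)
  also have "\<dots> \<le> \<epsilon> / 8"
    using divide_right_mono[OF inv, of 4] by simp
  finally have strip: "(2 * real n * (2 * q) + 2) / (8 * q ^ 3) \<le> \<epsilon> / 8" .
  show ?thesis
    using add_mono[OF tail strip] \<epsilon> by linarith
qed

section \<open>The generator and its seed length\<close>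

lemma exists_halfspace_generator:
  fixes n t :: nat
  assumes \<epsilon>: "0 < \<epsilon>" "\<epsilon> < 1 / 4" and n: "n \<ge> 2" and t: "2 ^ t \<ge> real n / \<epsilon>"
  shows "\<exists>G \<in> bit_strings (7 * t) \<rightarrow> Rn n. \<forall>h\<in>halfspaces n.
    \<bar>(LINT x|std_gaussian n. h x)
      - measure_pmf.expectation (pmf_of_set (bit_strings (7 * t))) (\<lambda>y. h (G y))\<bar> \<le> \<epsilon>"
proof -
  interpret P: prob_space "std_gaussian n"
    by (rule prob_space_std_gaussian)
  let ?I = "bit_strings (7 * t)"
  define R K where "R = (2 * 2 ^ t :: nat)" and "K = (8 * (2 ^ t) ^ 3 :: nat)"
  have "real (card (cells n R K)) \<le> real ((2 * K + 1) ^ n * (2 * (n * K * R) + 2))"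
    using card_cells_le by (intro of_nat_mono)
  also have "\<dots> = (16 * (2 ^ t) ^ 3 + 1) ^ n * (32 * real n * (2 ^ t) ^ 4 + 2)"
    by (simp add: R_def K_def power_numeral_reduce algebra_simps)
  finally have card: "2 * real (card (cells n R K)) * exp (- 2 * real (card ?I) * (\<epsilon> / 16)\<^sup>2)
      \<le> 2 * ((16 * (2 ^ t) ^ 3 + 1) ^ n * (32 * real n * (2 ^ t) ^ 4 + 2)) * exp (- 2 * (2 ^ t) ^ 7 * (\<epsilon> / 16)\<^sup>2)"
    by (simp add: mult.commute[of 7] flip: power_mult)
  have sets: "cells n R K \<subseteq> P.events"
    by (auto simp: cells_def cell_in_sets)
  obtain G where G: "G \<in> ?I \<rightarrow> space (std_gaussian n)"
    "\<And>A. A \<in> cells n R K \<Longrightarrow> \<bar>P.prob A - measure_pmf.prob (map_pmf G (pmf_of_set ?I)) A\<bar> \<le> \<epsilon> / 16"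
    using P.exists_uniform_sample[of ?I "cells n R K" "\<epsilon> / 16"]
      sets \<epsilon> le_less_trans[OF card sample_size_sufficient[OF \<epsilon> n t]] by auto
  define \<mu> where "\<mu> = map_pmf G (pmf_of_set ?I)"
  have set_\<mu>: "set_pmf \<mu> \<subseteq> Rn n"
    using G by (auto simp: \<mu>_def)
  have "\<bar>(LINT x|std_gaussian n. h x) - measure_pmf.expectation (pmf_of_set ?I) (\<lambda>y. h (G y))\<bar> \<le> \<epsilon>"
    if h_in: "h \<in> halfspaces n" for h
  proof -
    obtain w c where h: "h = (\<lambda>x. sign_pm (inner_prod n w x - c))"
      using h_in by (auto simp: halfspaces_def)
    let ?H = "{x \<in> Rn n. inner_prod n w x \<ge> c}"
    have Eg: "(LINT x|std_gaussian n. h x) = 2 * P.prob ?H - 1"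
      using integral_sign_pm[OF P.prob_space_axioms, of "\<lambda>x. inner_prod n w x - c"]
      by (simp add: h halfspace_in_sets)
    have "measure_pmf.expectation (pmf_of_set ?I) (\<lambda>y. h (G y)) = measure_pmf.expectation \<mu> h"
      by (simp add: \<mu>_def)
    also have "\<dots> = 2 * measure_pmf.prob \<mu> {x. inner_prod n w x \<ge> c} - 1"
      using integral_sign_pm[OF measure_pmf.prob_space_axioms, of \<mu> "\<lambda>x. inner_prod n w x - c"]
      by (simp add: h)
    \<comment> \<open>The space of a pmf is the whole type, so the halfspace has to be restricted to
      \<open>Rn n\<close>, where \<mu> is supported.\<close>
    also have "measure_pmf.prob \<mu> {x. inner_prod n w x \<ge> c} = measure_pmf.prob \<mu> ?H"
      using set_\<mu> by (intro measure_pmf.finite_measure_eq_AE) (auto simp: AE_measure_pmf_iff)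
    finally have E\<mu>: "measure_pmf.expectation (pmf_of_set ?I) (\<lambda>y. h (G y)) = 2 * measure_pmf.prob \<mu> ?H - 1" .
    have "\<bar>P.prob ?H - measure_pmf.prob \<mu> ?H\<bar> \<le> \<epsilon> / 2"
    \<comment> \<open>A zero normal vector cannot be scaled. Its halfspace is all of
      \<open>Rn n\<close> or empty, and both measures agree on it exactly.\<close>
    proof (cases "\<exists>i<n. w i \<noteq> 0")
      case True
      then obtain i where i: "i < n" "w i \<noteq> 0"
        by auto
      have "\<bar>P.prob ?H - measure_pmf.prob \<mu> ?H\<bar>
          \<le> 2 * (\<epsilon> / 16) + real n / (real R)\<^sup>2 + (2 * real n * real R + 2) / real K"
        using G(2) i by (intro halfspace_discrepancy_le) (auto simp: \<mu>_def R_def K_def)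
      also have "\<dots> \<le> \<epsilon> / 2"
        using cells_error_le[OF \<epsilon> n t] by (simp add: R_def K_def)
      finally show ?thesis .
    next
      case False
      then have "inner_prod n w x = 0" for x
        by (simp add: inner_prod_def)
      moreover have "measure_pmf.prob \<mu> (Rn n) = 1"
        using set_\<mu> by (simp add: measure_pmf.prob_eq_1 AE_measure_pmf_iff subset_eq)
      ultimately show ?thesis
        using P.prob_space \<epsilon> by (cases "c \<le> 0") auto
    qed
    then show ?thesis
      unfolding Eg E\<mu> by linarith
  qed
  then show ?thesis
    using G(1) by auto
qed

theorem mainTheorem3:
  "\<exists>C::real. C > 0 \<and>
    (\<forall>n::nat. \<forall>\<epsilon>::real. n \<ge> 2 \<longrightarrow> 0 < \<epsilon> \<longrightarrow> \<epsilon> < 1 / 4 \<longrightarrow>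
      (\<exists>s::nat. real s \<le> C * (log 2 (real n) + log 2 (log 2 (1 / \<epsilon>)) * log 2 (1 / \<epsilon>)) \<and>
        (\<exists>G. G \<in> bit_strings s \<rightarrow> Rn n \<and>
          (\<forall>h\<in>halfspaces n.
            \<bar>(LINT x|std_gaussian n. h x)
              - measure_pmf.expectation (pmf_of_set (bit_strings s)) (\<lambda>y. h (G y))\<bar> \<le> \<epsilon>))))"
\<comment> \<open>The constant is 7 * 2: the seed has 7 t bits, and t is at most log n + L + 1,
  which is at most twice log n + L.\<close>
proof (intro exI[of _ "14::real"] conjI allI impI)
  fix n :: nat and \<epsilon> :: real
  assume n: "n \<ge> 2" and \<epsilon>: "0 < \<epsilon>" "\<epsilon> < 1 / 4"
  define L where "L = log 2 (1 / \<epsilon>)"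
  define t where "t = nat \<lceil>log 2 (real n / \<epsilon>)\<rceil>"
  have "log 2 (2 ^ 2) \<le> L"
    unfolding L_def using \<epsilon> by (subst log_le_cancel_iff) (auto simp: field_simps)
  then have L: "L \<ge> 2"
    by (subst (asm) log_pow_cancel) auto
  \<comment> \<open>The assumption \<epsilon> < 1/4 enters here: it makes log log (1 / \<epsilon>)
    at least 1, so a seed length of order log n + log (1 / \<epsilon>) fits the required
    bound.\<close>
  then have "log 2 2 \<le> log 2 L"
    by (subst log_le_cancel_iff) auto
  then have logL: "L \<le> log 2 L * L"
    using L mult_right_mono[of 1 "log 2 L" L] by simp
  have log_n: "log 2 (real n) \<ge> 0"
    using n by simp
  have split: "log 2 (real n / \<epsilon>) = log 2 (real n) + L"
    using n \<epsilon> by (simp add: L_def log_divide)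
  have t_ge: "log 2 (real n / \<epsilon>) \<le> real t" and t_le: "real t \<le> log 2 (real n) + L + 1"
    using split log_n L unfolding t_def by linarith+
  have "real n / \<epsilon> = 2 powr (log 2 (real n / \<epsilon>))"
    using n \<epsilon> by simp
  also have "\<dots> \<le> 2 powr real t"
    using t_ge by simp
  finally have t: "2 ^ t \<ge> real n / \<epsilon>"
    by (simp add: powr_realpow)
  have "real (7 * t) \<le> 14 * (log 2 (real n) + L)"
    using t_le L log_n by simp
  also have "\<dots> \<le> 14 * (log 2 (real n) + log 2 L * L)"
    using logL by (intro mult_left_mono add_left_mono) auto
  finally have "real (7 * t) \<le> 14 * (log 2 (real n) + log 2 L * L)" .
  with exists_halfspace_generator[OF \<epsilon> n t]
  show "\<exists>s::nat. real s \<le> 14 * (log 2 (real n) + log 2 (log 2 (1 / \<epsilon>)) * log 2 (1 / \<epsilon>)) \<and>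
        (\<exists>G. G \<in> bit_strings s \<rightarrow> Rn n \<and>
          (\<forall>h\<in>halfspaces n.
            \<bar>(LINT x|std_gaussian n. h x)
              - measure_pmf.expectation (pmf_of_set (bit_strings s)) (\<lambda>y. h (G y))\<bar> \<le> \<epsilon>))"
    unfolding L_def by blast
qed simp

end
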